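(* Let $(K;S)$ be a topological dynamical system. Identify $K$ with its homeomorphic copy $\{\delta_x\mid x\in K\}\subset \mathrm{C}(K)'$, where $\mathrm{C}(K)'$ is equipped with the weak* topology. Let $\mathrm{E}(K;S):=\overline{\{\varphi_s\mid s\in S\}}\subset K^K$ be the classical Ellis semigroup and let $\mathcal{E}(K;S)$ be the Ellis semigroup defined as an operator semigroup on $\ell^1(K)$. Then the mapping $$\mathcal{E}(K;S)\to\mathrm{E}(K;S),\quad R\mapsto R|_K$$ is an isomorphism of right topological semigroups.
   Context: Compact spaces are Hausdorff; vector spaces are complex. A semigroup with a topology is semitopological if multiplication is separately continuous. A topological dynamical system $(K;S)$ is a compact space $K$ with a semitopological semigroup $S$ acting on $K$ such that $S\times K\to K$, $(s,x)\mapsto sx$ is continuous; $\varphi_s\colon K\to K$, $x\mapsto sx$. The Koopman operators are $T_sf(x)=f(sx)$ on $\mathrm{C}(K)$, $\mathcal{T}_S=\{T_s\mid s\in S\}$, $\mathcal{T}_S'=\{T_s'\mid s\in S\}$ on $\mathrm{C}(K)'$ (regular Borel measures on $K$). $\ell^1(K)=\{(a_x)_{x\in K}\in\mathbb{C}^K\mid\sum_x|a_x|<\infty\}$ is identified with the discrete measures in $\mathrm{C}(K)'$; it is $\mathcal{T}_S'$-invariant. The Ellis semigroup $\mathcal{E}(K;S)$ is the closure of $\{T_s'|_{\ell^1(K)}\mid s\in S\}$ in $\ell^1(K)^{\ell^1(K)}$ with the product topology, where $\ell^1(K)$ carries the topology $\sigma(\ell^1(K),\mathrm{C}(K))$; multiplication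 is composition. $K^K$ carries the product topology, and multiplication in $\mathrm{E}(K;S)$ is composition. A right topological semigroup is one in which $s\mapsto st$ is continuous for each $t$. An isomorphism of right topological semigroups is a multiplicative homeomorphism. *)

theory Defs
  imports "HOL-Analysis.Analysis"
begin

(* Spaces are abstract topologies, so an element of X^A is a function that is extensional on A. *)

section \<open>Semigroups with a topology\<close>

definition semigroup_on :: "'a set \<Rightarrow> ('a \<Rightarrow> 'a \<Rightarrow> 'a) \<Rightarrow> bool" where
  "semigroup_on A m \<longleftrightarrow>
     (\<forall>s\<in>A. \<forall>t\<in>A. m s t \<in> A) \<and>
     (\<forall>s\<in>A. \<forall>t\<in>A. \<forall>u\<in>A. m (m s t) u = m s (m t u))"

definition semitopological_semigroup :: "'a topology \<Rightarrow> ('a \<Rightarrow> 'a \<Rightarrow> 'a) \<Rightarrow> bool" where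
  "semitopological_semigroup X m \<longleftrightarrow>
     semigroup_on (topspace X) m \<and>
     (\<forall>t\<in>topspace X. continuous_map X X (\<lambda>s. m s t)) \<and>
     (\<forall>s\<in>topspace X. continuous_map X X (\<lambda>t. m s t))"

definition right_topological_semigroup :: "'a topology \<Rightarrow> ('a \<Rightarrow> 'a \<Rightarrow> 'a) \<Rightarrow> bool" where
  "right_topological_semigroup X m \<longleftrightarrow>
     semigroup_on (topspace X) m \<and>
     (\<forall>t\<in>topspace X. continuous_map X X (\<lambda>s. m s t))"

definition right_topological_semigroup_iso ::
  "'a topology \<Rightarrow> ('a \<Rightarrow> 'a \<Rightarrow> 'a) \<Rightarrow> 'b topology \<Rightarrow> ('b \<Rightarrow> 'b \<Rightarrow> 'b) \<Rightarrow> ('a \<Rightarrow> 'b) \<Rightarrow> bool" where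
  "right_topological_semigroup_iso X m Y n h \<longleftrightarrow>
     right_topological_semigroup X m \<and>
     right_topological_semigroup Y n \<and>
     homeomorphic_map X Y h \<and>
     (\<forall>s\<in>topspace X. \<forall>t\<in>topspace X. h (m s t) = n (h s) (h t))"


section \<open>Topological dynamical systems\<close>

definition topological_dynamical_system ::
  "'k topology \<Rightarrow> 's topology \<Rightarrow> ('s \<Rightarrow> 's \<Rightarrow> 's) \<Rightarrow> ('s \<Rightarrow> 'k \<Rightarrow> 'k) \<Rightarrow> bool" where
  "topological_dynamical_system K S mul act \<longleftrightarrow>
     compact_space K \<and> Hausdorff_space K \<and>
     semitopological_semigroup S mul \<and>
     (\<forall>s\<in>topspace S. \<forall>t\<in>topspace S. \<forall>x\<in>topspace K. act (mul s t) x = act s (act t x)) \<and>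
     continuous_map (prod_topology S K) K (\<lambda>(s, x). act s x)"

definition ellis_semigroup ::
  "'k topology \<Rightarrow> 's topology \<Rightarrow> ('s \<Rightarrow> 'k \<Rightarrow> 'k) \<Rightarrow> ('k \<Rightarrow> 'k) topology" where
  "ellis_semigroup K S act =
     (let KK = product_topology (\<lambda>_. K) (topspace K)
      in subtopology KK (KK closure_of {restrict (act s) (topspace K) | s. s \<in> topspace S}))"


section \<open>The space of continuous functions and its dual\<close>

definition C_space :: "'k topology \<Rightarrow> ('k \<Rightarrow> complex) set" where
  "C_space K = {f \<in> extensional (topspace K). continuous_map K euclidean f}"

(* The 0 makes this the norm also if K is empty. *)
definition sup_norm :: "'k topology \<Rightarrow> ('k \<Rightarrow> complex) \<Rightarrow> real" where
  "sup_norm K f = Sup (insert 0 ((\<lambda>x. norm (f x)) ` topspace K))"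

definition C_dual :: "'k topology \<Rightarrow> (('k \<Rightarrow> complex) \<Rightarrow> complex) set" where
  "C_dual K = {L \<in> extensional (C_space K).
     (\<forall>f\<in>C_space K. \<forall>g\<in>C_space K. L (\<lambda>x\<in>topspace K. f x + g x) = L f + L g) \<and>
     (\<forall>c. \<forall>f\<in>C_space K. L (\<lambda>x\<in>topspace K. c * f x) = c * L f) \<and>
     (\<exists>B. \<forall>f\<in>C_space K. norm (L f) \<le> B * sup_norm K f)}"

definition weak_star :: "'k topology \<Rightarrow> (('k \<Rightarrow> complex) \<Rightarrow> complex) topology" where
  "weak_star K = subtopology (product_topology (\<lambda>_. euclidean) (C_space K)) (C_dual K)"

definition dirac :: "'k topology \<Rightarrow> 'k \<Rightarrow> ('k \<Rightarrow> complex) \<Rightarrow> complex" where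
  "dirac K x = (\<lambda>f\<in>C_space K. f x)"

definition discrete_measure ::
  "'k topology \<Rightarrow> ('k \<Rightarrow> complex) \<Rightarrow> ('k \<Rightarrow> complex) \<Rightarrow> complex" where
  "discrete_measure K a = (\<lambda>f\<in>C_space K. \<Sum>\<^sub>\<infinity>x\<in>topspace K. a x * f x)"

(* The copy of l^1(K) inside the dual of C(K). *)
definition ell1 :: "'k topology \<Rightarrow> (('k \<Rightarrow> complex) \<Rightarrow> complex) set" where
  "ell1 K = discrete_measure K `
     {a \<in> extensional (topspace K). (\<lambda>x. norm (a x)) summable_on topspace K}"

(* The topology sigma(l^1(K), C(K)). *)
definition ell1_topology :: "'k topology \<Rightarrow> (('k \<Rightarrow> complex) \<Rightarrow> complex) topology" where
  "ell1_topology K = subtopology (weak_star K) (ell1 K)"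


section \<open>Koopman operators and the Ellis semigroup on the discrete measures\<close>

definition koopman ::
  "'k topology \<Rightarrow> ('s \<Rightarrow> 'k \<Rightarrow> 'k) \<Rightarrow> 's \<Rightarrow> ('k \<Rightarrow> complex) \<Rightarrow> ('k \<Rightarrow> complex)" where
  "koopman K act s f = (\<lambda>x\<in>topspace K. f (act s x))"

definition koopman_dual ::
  "'k topology \<Rightarrow> ('s \<Rightarrow> 'k \<Rightarrow> 'k) \<Rightarrow> 's \<Rightarrow> (('k \<Rightarrow> complex) \<Rightarrow> complex) \<Rightarrow> (('k \<Rightarrow> complex) \<Rightarrow> complex)"
  where
  "koopman_dual K act s L = (\<lambda>f\<in>C_space K. L (koopman K act s f))"

definition operator_ellis_semigroup ::
  "'k topology \<Rightarrow> 's topology \<Rightarrow> ('s \<Rightarrow> 'k \<Rightarrow> 'k) \<Rightarrow>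
     ((('k \<Rightarrow> complex) \<Rightarrow> complex) \<Rightarrow> (('k \<Rightarrow> complex) \<Rightarrow> complex)) topology" where
  "operator_ellis_semigroup K S act =
     (let LL = product_topology (\<lambda>_. ell1_topology K) (ell1 K)
      in subtopology LL
           (LL closure_of {restrict (koopman_dual K act s) (ell1 K) | s. s \<in> topspace S}))"

(* R|_K as a self-map of K, after identifying x with dirac K x.  It is meaningful only if
   dirac K is injective and R maps Dirac functionals to Dirac functionals. *)
definition restrict_to_points ::
  "'k topology \<Rightarrow> ((('k \<Rightarrow> complex) \<Rightarrow> complex) \<Rightarrow> (('k \<Rightarrow> complex) \<Rightarrow> complex)) \<Rightarrow> 'k \<Rightarrow> 'k" where
  "restrict_to_points K R =
     (\<lambda>x\<in>topspace K. the_inv_into (topspace K) (dirac K) (R (dirac K x)))"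

end

theory Submission imports Defs begin

text \<open>
  The inverse of \<open>R \<mapsto> R|\<^sub>K\<close> can be written down: a self-map \<open>h\<close> of \<open>K\<close> should act on discrete
  measures by \<open>\<Sum> a\<^sub>x \<delta>\<^sub>x \<mapsto> \<Sum> a\<^sub>x \<delta>\<^bsub>h x\<^esub>\<close> (\<open>push_operator\<close>).  Tested against a continuous function
  \<open>f\<close> the image is \<open>\<Sum> a\<^sub>x f (h x)\<close>, a series of continuous functions of \<open>h \<in> K\<^sup>K\<close> that converges
  uniformly in \<open>h\<close> because \<open>a\<close> is summable and \<open>f\<close> is bounded.  Hence \<open>push_operator\<close> is continuous
  from \<open>K\<^sup>K\<close> to the space of self-maps of \<open>\<ell>\<^sup>1(K)\<close> with pointwise topology
  (\<open>continuous_map_push_operator\<close>), and it takes \<open>\<phi>\<^sub>s\<close> to the restricted dual Koopman operator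
  (\<open>push_operator_orbit_map\<close>).  The classical Ellis semigroup is compact, so its image is closed,
  and therefore equals the closure of the dual Koopman operators
  (\<open>push_operator_image_ellis_set\<close>).

  On a Dirac functional the image operator is \<open>\<delta>\<^sub>x \<mapsto> \<delta>\<^bsub>h x\<^esub>\<close> (\<open>push_operator_dirac\<close>), so \<open>h\<close> can be
  recovered from it.  A continuous bijection from a compact space onto a Hausdorff space is a
  homeomorphism, whence so is its inverse \<open>restrict_to_points\<close>; and that map is multiplicative
  because composites of operators act on Dirac functionals by composing the underlying maps.

  Both objects are right topological semigroups for one reason: they are pointwise closures of
  semigroups of continuous self-maps (\<open>right_topological_semigroup_closure_of\<close>).
\<close>

section \<open>Closures of semigroups of continuous self-maps\<close>

lemma continuous_map_precompose:
  assumes "g \<in> A \<rightarrow> A"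
  shows "continuous_map (product_topology (\<lambda>_. X) A) (product_topology (\<lambda>_. X) A) (\<lambda>h. compose A h g)"
  using assms by (auto simp: continuous_map_componentwise compose_def intro!: continuous_map_product_projection)

lemma continuous_map_postcompose:
  assumes "continuous_map X X p"
  shows "continuous_map (product_topology (\<lambda>_. X) A) (product_topology (\<lambda>_. X) A) (\<lambda>h. compose A p h)"
proof -
  have "continuous_map (product_topology (\<lambda>_. X) A) X (\<lambda>h. p (h k))" if "k \<in> A" for k
    using continuous_map_compose[OF continuous_map_product_projection[of k A "\<lambda>_. X"] assms] that
    by (simp add: o_def)
  then show ?thesis
    by (auto simp: continuous_map_componentwise compose_def)
qed

text \<open>Composition is continuous in its left argument always, but in its right argument only if the left
  argument is a continuous map.  So products are shown to stay in the closure in two steps: first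
  the left factor is taken in \<open>T\<close> and the right one moves into the closure, then the right one is
  fixed there and the left one moves.\<close>

lemma right_topological_semigroup_closure_of:
  fixes X :: "'a topology"
  defines "A \<equiv> topspace X"
  defines "P \<equiv> product_topology (\<lambda>_. X) A"
  assumes cont: "\<And>t. t \<in> T \<Longrightarrow> continuous_map X X t"
    and ext: "T \<subseteq> extensional A"
    and closed: "\<And>s t. s \<in> T \<Longrightarrow> t \<in> T \<Longrightarrow> compose A s t \<in> T"
  shows "right_topological_semigroup (subtopology P (P closure_of T)) (compose A)"
proof -
  let ?E = "P closure_of T"
  have topP: "topspace P = A \<rightarrow>\<^sub>E A"
    by (simp add: P_def A_def)
  have E_sub: "?E \<subseteq> A \<rightarrow>\<^sub>E A"
    using closure_of_subset_topspace[of P T] topP by simp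
  have T_sub: "T \<subseteq> A \<rightarrow>\<^sub>E A"
  proof
    fix t assume "t \<in> T"
    with cont ext show "t \<in> A \<rightarrow>\<^sub>E A"
      using continuous_map_funspace[of X X t] by (auto simp: PiE_def A_def)
  qed
  have pre: "continuous_map P P (\<lambda>h. compose A h g)" if "g \<in> ?E" for g
    unfolding P_def using that E_sub by (intro continuous_map_precompose) auto
  have left: "compose A t g \<in> ?E" if "t \<in> T" "g \<in> ?E" for t g
  proof -
    have "continuous_map P P (compose A t)"
      unfolding P_def by (rule continuous_map_postcompose[OF cont[OF that(1)]])
    then have "compose A t ` ?E \<subseteq> P closure_of (compose A t ` T)"
      by (rule continuous_map_image_closure_subset)
    also have "\<dots> \<subseteq> ?E"
      using closed that(1) by (intro closure_of_mono) auto
    finally show ?thesis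
      using that(2) by auto
  qed
  have mult: "compose A h g \<in> ?E" if "h \<in> ?E" "g \<in> ?E" for h g
  proof -
    have "(\<lambda>h. compose A h g) ` ?E \<subseteq> P closure_of ((\<lambda>h. compose A h g) ` T)"
      by (rule continuous_map_image_closure_subset[OF pre[OF that(2)]])
    also have "\<dots> \<subseteq> ?E"
      using left that(2) by (intro closure_of_minimal) auto
    finally show ?thesis
      using that(1) by auto
  qed
  have "compose A (compose A s t) u = compose A s (compose A t u)"
    if "u \<in> ?E" for s t u :: "'a \<Rightarrow> 'a"
  proof -
    have "u \<in> A \<rightarrow> A"
      using subsetD[OF E_sub that] by (simp add: PiE_iff Pi_iff)
    then show ?thesis
      by (rule compose_assoc[symmetric])
  qed
  moreover have "topspace (subtopology P ?E) = ?E"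
    using closure_of_subset_topspace[of P T] by (simp add: Int_absorb1)
  moreover have "continuous_map (subtopology P ?E) (subtopology P ?E) (\<lambda>h. compose A h g)"
    if "g \<in> ?E" for g
    using continuous_map_from_subtopology[OF pre[OF that], of ?E] mult[OF _ that] closure_of_subset_topspace[of P T]
    by (simp add: continuous_map_in_subtopology Pi_iff)
  ultimately show ?thesis
    unfolding right_topological_semigroup_def semigroup_on_def using mult by simp
qed

section \<open>Absolutely summable families and their images\<close>

definition ell1_coeffs :: "'k topology \<Rightarrow> ('k \<Rightarrow> complex) set" where
  "ell1_coeffs K = {a \<in> extensional (topspace K). (\<lambda>x. norm (a x)) summable_on topspace K}"

lemma ell1_eq: "ell1 K = discrete_measure K ` ell1_coeffs K"
  by (simp add: ell1_def ell1_coeffs_def)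

lemma
  fixes a g :: "'a \<Rightarrow> complex"
  assumes a: "(\<lambda>x. norm (a x)) summable_on A" and g: "\<And>x. x \<in> A \<Longrightarrow> norm (g x) \<le> B"
  shows abs_summable_mult_bounded: "(\<lambda>x. norm (a x * g x)) summable_on A"
    and norm_infsum_mult_bounded: "norm (\<Sum>\<^sub>\<infinity>x\<in>A. a x * g x) \<le> (\<Sum>\<^sub>\<infinity>x\<in>A. norm (a x)) * B"
proof -
  have aB: "(\<lambda>x. norm (a x) * B) summable_on A"
    using a by (rule summable_on_cmult_left)
  have le: "norm (a x * g x) \<le> norm (a x) * B" if "x \<in> A" for x
    using g[OF that] by (simp add: norm_mult mult_left_mono)
  show s: "(\<lambda>x. norm (a x * g x)) summable_on A"
    by (rule summable_on_comparison_test[OF aB le]) auto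
  have "norm (\<Sum>\<^sub>\<infinity>x\<in>A. a x * g x) \<le> (\<Sum>\<^sub>\<infinity>x\<in>A. norm (a x * g x))"
    by (rule norm_infsum_bound[OF s])
  also have "\<dots> \<le> (\<Sum>\<^sub>\<infinity>x\<in>A. norm (a x) * B)"
    by (rule infsum_mono[OF s aB le])
  also have "\<dots> = (\<Sum>\<^sub>\<infinity>x\<in>A. norm (a x)) * B"
    by (rule infsum_cmult_left')
  finally show "norm (\<Sum>\<^sub>\<infinity>x\<in>A. a x * g x) \<le> (\<Sum>\<^sub>\<infinity>x\<in>A. norm (a x)) * B" .
qed

text \<open>The coefficients of \<open>\<Sum> a\<^sub>x \<delta>\<^bsub>h x\<^esub>\<close> after collecting equal points, that is, the image of the
  complex measure \<open>a\<close> under \<open>h\<close>.\<close>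

definition push_coeffs :: "'k topology \<Rightarrow> ('k \<Rightarrow> 'k) \<Rightarrow> ('k \<Rightarrow> complex) \<Rightarrow> 'k \<Rightarrow> complex" where
  "push_coeffs K h a = (\<lambda>y\<in>topspace K. \<Sum>\<^sub>\<infinity>x\<in>{x \<in> topspace K. h x = y}. a x)"

text \<open>Summing over \<open>K\<close> is the same as summing first over each fibre of \<open>h\<close> and then over the values of
  \<open>h\<close>; absolute summability justifies the rearrangement.\<close>

lemma
  assumes h: "h \<in> topspace K \<rightarrow> topspace K" and a: "a \<in> ell1_coeffs K"
  shows push_coeffs_in: "push_coeffs K h a \<in> ell1_coeffs K"
    and infsum_push_coeffs:
      "(\<And>x. x \<in> topspace K \<Longrightarrow> norm (F x) \<le> B) \<Longrightarrow>
        (\<Sum>\<^sub>\<infinity>y\<in>topspace K. push_coeffs K h a y * F y) = (\<Sum>\<^sub>\<infinity>x\<in>topspace K. a x * F (h x))"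
proof -
  let ?X = "topspace K"
  let ?fib = "\<lambda>y. {x \<in> ?X. h x = y}"
  have bij: "bij_betw (\<lambda>x. (h x, x)) ?X (Sigma ?X ?fib)"
    using h by (auto simp: bij_betw_def inj_on_def)
  have sa: "(\<lambda>x. norm (a x)) summable_on ?X"
    using a by (simp add: ell1_coeffs_def)
  have sfib: "(\<lambda>x. norm (a x)) summable_on ?fib y" for y
    by (rule summable_on_subset_banach[OF sa]) auto
  have "(\<lambda>(y, x). norm (a x)) summable_on Sigma ?X ?fib"
    using sa summable_on_reindex_bij_betw[OF bij, of "\<lambda>(y, x). norm (a x)"] by simp
  then have "(\<lambda>y. \<Sum>\<^sub>\<infinity>x\<in>?fib y. norm (a x)) summable_on ?X"
    by (rule summable_on_Sigma_banach)
  then have "(\<lambda>y. norm (push_coeffs K h a y)) summable_on ?X"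
    by (rule summable_on_comparison_test)
      (use norm_infsum_bound[OF sfib] in \<open>auto simp: push_coeffs_def\<close>)
  then show "push_coeffs K h a \<in> ell1_coeffs K"
    by (simp add: ell1_coeffs_def push_coeffs_def)
  assume F: "\<And>x. x \<in> ?X \<Longrightarrow> norm (F x) \<le> B"
  have "(\<lambda>x. norm (a x * F (h x))) summable_on ?X"
    using h by (intro abs_summable_mult_bounded[OF sa, where B = B] F) auto
  then have "(\<lambda>x. a x * F (h x)) summable_on ?X"
    by (rule abs_summable_summable)
  then have sum: "(\<lambda>(y, x). a x * F y) summable_on Sigma ?X ?fib"
    using summable_on_reindex_bij_betw[OF bij, of "\<lambda>(y, x). a x * F y"] by simp
  have "(\<Sum>\<^sub>\<infinity>y\<in>?X. push_coeffs K h a y * F y) = (\<Sum>\<^sub>\<infinity>y\<in>?X. \<Sum>\<^sub>\<infinity>x\<in>?fib y. a x * F y)"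
    by (intro infsum_cong) (simp add: push_coeffs_def infsum_cmult_left')
  also have "\<dots> = (\<Sum>\<^sub>\<infinity>(y, x)\<in>Sigma ?X ?fib. a x * F y)"
    by (rule infsum_Sigma'_banach[OF sum])
  also have "\<dots> = (\<Sum>\<^sub>\<infinity>x\<in>?X. a x * F (h x))"
    using infsum_reindex_bij_betw[OF bij, of "\<lambda>(y, x). a x * F y"] by simp
  finally show "(\<Sum>\<^sub>\<infinity>y\<in>?X. push_coeffs K h a y * F y) = (\<Sum>\<^sub>\<infinity>x\<in>?X. a x * F (h x))" .
qed

section \<open>Point masses and discrete measures as functionals\<close>

lemma
  assumes K: "compact_space K" and f: "f \<in> C_space K"
  shows norm_le_sup_norm: "x \<in> topspace K \<Longrightarrow> norm (f x) \<le> sup_norm K f"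
    and sup_norm_nonneg: "0 \<le> sup_norm K f"
proof -
  have "compact (f ` topspace K)"
    using image_compactin[of K "topspace K" euclidean f] K f
    by (simp add: C_space_def compact_space_def)
  then have "bdd_above (norm ` f ` topspace K)"
    by (simp add: compact_imp_bounded bounded_imp_bdd_above bdd_above_norm)
  then have bdd: "bdd_above (insert 0 ((\<lambda>x. norm (f x)) ` topspace K))"
    by (simp add: image_image)
  show "norm (f x) \<le> sup_norm K f" if "x \<in> topspace K"
    unfolding sup_norm_def using that by (intro cSup_upper bdd) auto
  show "0 \<le> sup_norm K f"
    unfolding sup_norm_def by (intro cSup_upper bdd) auto
qed

lemma C_space_add: "f \<in> C_space K \<Longrightarrow> g \<in> C_space K \<Longrightarrow> (\<lambda>x\<in>topspace K. f x + g x) \<in> C_space K"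
  unfolding C_space_def
  by (auto intro!: continuous_map_eq[where f = "\<lambda>x. f x + g x"] continuous_map_add)

lemma C_space_cmult: "f \<in> C_space K \<Longrightarrow> (\<lambda>x\<in>topspace K. c * f x) \<in> C_space K"
proof -
  assume f: "f \<in> C_space K"
  have "continuous_map K euclidean ((\<lambda>z. c * z) \<circ> f)"
    using f by (intro continuous_map_compose[where X' = euclidean])
      (auto simp: C_space_def intro!: continuous_intros)
  then show ?thesis
    unfolding C_space_def by (auto intro: continuous_map_eq)
qed

lemma ell1_subset_C_dual:
  assumes K: "compact_space K"
  shows "ell1 K \<subseteq> C_dual K"
proof
  fix L assume "L \<in> ell1 K"
  then obtain a where a: "(\<lambda>x. norm (a x)) summable_on topspace K" and L: "L = discrete_measure K a"
    by (auto simp: ell1_def)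
  have s: "(\<lambda>x. a x * f x) summable_on topspace K" if "f \<in> C_space K" for f
    using abs_summable_mult_bounded[OF a norm_le_sup_norm[OF K that]] by (rule abs_summable_summable)
  have "L (\<lambda>x\<in>topspace K. f x + g x) = L f + L g" if "f \<in> C_space K" "g \<in> C_space K" for f g
    using that C_space_add[OF that]
    by (simp add: L discrete_measure_def distrib_left infsum_add[OF s s, symmetric] cong: infsum_cong)
  moreover have "L (\<lambda>x\<in>topspace K. c * f x) = c * L f" if "f \<in> C_space K" for c f
    using that C_space_cmult[OF that, of c]
    by (simp add: L discrete_measure_def infsum_cmult_right'[symmetric] mult.left_commute cong: infsum_cong)
  moreover have "norm (L f) \<le> (\<Sum>\<^sub>\<infinity>x\<in>topspace K. norm (a x)) * sup_norm K f" if "f \<in> C_space K" for f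
    using norm_infsum_mult_bounded[OF a norm_le_sup_norm[OF K that]] that
    by (simp add: L discrete_measure_def)
  moreover have "L \<in> extensional (C_space K)"
    by (simp add: L discrete_measure_def)
  ultimately show "L \<in> C_dual K"
    unfolding C_dual_def by blast
qed

text \<open>The topology is defined on the intersection of the discrete measures with the dual, so this needs
  the boundedness of integration against a discrete measure.\<close>

lemma topspace_ell1_topology: "compact_space K \<Longrightarrow> topspace (ell1_topology K) = ell1 K"
  using ell1_subset_C_dual[of K]
  by (auto simp: ell1_topology_def weak_star_def C_dual_def PiE_def)

lemma Hausdorff_weak_star: "Hausdorff_space (weak_star K)"
  unfolding weak_star_def by (intro Hausdorff_space_subtopology) (simp add: Hausdorff_space_product_topology)

lemma Hausdorff_ell1_topology: "Hausdorff_space (ell1_topology K)"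
  unfolding ell1_topology_def by (intro Hausdorff_space_subtopology Hausdorff_weak_star)

lemma continuous_map_into_ell1_topology:
  assumes "compact_space K"
  shows "continuous_map X (ell1_topology K) \<Phi> \<longleftrightarrow>
    \<Phi> \<in> topspace X \<rightarrow> ell1 K \<and> (\<forall>f\<in>C_space K. continuous_map X euclidean (\<lambda>x. \<Phi> x f))"
proof -
  have "ell1_topology K = subtopology (product_topology (\<lambda>_. euclidean) (C_space K)) (ell1 K)"
    using ell1_subset_C_dual[OF assms]
    by (simp add: ell1_topology_def weak_star_def subtopology_subtopology Int_absorb1)
  moreover have "\<Phi> ` topspace X \<subseteq> extensional (C_space K)" if "\<Phi> \<in> topspace X \<rightarrow> ell1 K"
    using that ell1_subset_C_dual[OF assms] by (fastforce simp: C_dual_def)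
  ultimately show ?thesis
    by (auto simp: continuous_map_in_subtopology continuous_map_componentwise)
qed

lemma continuous_map_ell1_eval:
  assumes "f \<in> C_space K"
  shows "continuous_map (ell1_topology K) euclidean (\<lambda>L. L f)"
  unfolding ell1_topology_def weak_star_def
  by (intro continuous_map_from_subtopology continuous_map_product_projection assms)

lemma dirac_eq_discrete_measure:
  assumes "x \<in> topspace K"
  obtains a where "a \<in> ell1_coeffs K" "dirac K x = discrete_measure K a"
    "\<And>g. (\<Sum>\<^sub>\<infinity>y\<in>topspace K. a y * g y) = g x"
proof -
  define a :: "'a \<Rightarrow> complex" where "a = (\<lambda>y\<in>topspace K. if y = x then 1 else 0)"
  have "(\<lambda>y. norm (a y)) summable_on {x}"
    by simp
  then have "(\<lambda>y. norm (a y)) summable_on topspace K"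
    by (rule summable_on_cong_neutral[THEN iffD1, rotated -1]) (use assms in \<open>auto simp: a_def\<close>)
  then have 1: "a \<in> ell1_coeffs K"
    by (simp add: ell1_coeffs_def a_def)
  have 2: "(\<Sum>\<^sub>\<infinity>y\<in>topspace K. a y * g y) = g x" for g
  proof -
    have "(\<Sum>\<^sub>\<infinity>y\<in>topspace K. a y * g y) = (\<Sum>\<^sub>\<infinity>y\<in>{x}. a y * g y)"
      by (rule infsum_cong_neutral) (use assms in \<open>auto simp: a_def\<close>)
    then show ?thesis
      using assms by (simp add: a_def)
  qed
  have "dirac K x = discrete_measure K a"
    by (simp add: dirac_def discrete_measure_def 2)
  with 1 2 that show thesis by blast
qed

lemma dirac_in_ell1: "x \<in> topspace K \<Longrightarrow> dirac K x \<in> ell1 K"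
  using dirac_eq_discrete_measure[of x K] by (metis ell1_eq image_eqI)

text \<open>Continuous functions separate points, by Urysohn's lemma.\<close>

lemma inj_on_dirac:
  assumes "compact_space K" "Hausdorff_space K"
  shows "inj_on (dirac K) (topspace K)"
proof (rule inj_onI, rule ccontr)
  fix x y assume xy: "x \<in> topspace K" "y \<in> topspace K" "dirac K x = dirac K y" "x \<noteq> y"
  have "normal_space K"
    using assms by (intro compact_Hausdorff_or_regular_imp_normal_space) auto
  moreover have "closedin K {x}" "closedin K {y}"
    using xy assms(2) by (auto intro: closedin_Hausdorff_singleton)
  ultimately obtain u :: "'a \<Rightarrow> real" where u: "continuous_map K euclidean u" "u x = 0" "u y = 1"
    using Urysohn_lemma_alt[of K "{x}" "{y}" 0 1] xy(4) by (metis disjnt_insert1 disjnt_empty1 image_insert image_empty insert_subset singleton_iff)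
  define f :: "'a \<Rightarrow> complex" where "f = (\<lambda>z\<in>topspace K. of_real (u z))"
  have "continuous_map K euclidean (complex_of_real \<circ> u)"
    by (rule continuous_map_compose[OF u(1)]) (auto intro!: continuous_intros)
  then have "f \<in> C_space K"
    unfolding f_def C_space_def by (auto intro: continuous_map_eq)
  then have "f x = f y"
    using fun_cong[OF xy(3), of f] by (simp add: dirac_def)
  with u xy show False
    by (simp add: f_def)
qed

lemma embedding_map_dirac:
  assumes "compact_space K" "Hausdorff_space K"
  shows "embedding_map K (weak_star K) (dirac K)"
proof (rule continuous_imp_embedding_map[OF _ assms(1) Hausdorff_weak_star inj_on_dirac[OF assms]])
  have "continuous_map K euclidean (\<lambda>x. dirac K x f)" if "f \<in> C_space K" for f
    using that by (simp add: dirac_def C_space_def)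
  then have "continuous_map K (ell1_topology K) (dirac K)"
    by (simp add: continuous_map_into_ell1_topology[OF assms(1)] dirac_in_ell1)
  then show "continuous_map K (weak_star K) (dirac K)"
    by (simp add: ell1_topology_def continuous_map_in_subtopology)
qed

section \<open>Operators induced by self-maps of the space\<close>

text \<open>Coefficients are chosen rather than shown to be unique; for the maps that matter the resulting
  operator is independent of the choice, see \<open>infsum_eq_of_discrete_measure_eq\<close>.\<close>

definition coeffs_of :: "'k topology \<Rightarrow> (('k \<Rightarrow> complex) \<Rightarrow> complex) \<Rightarrow> 'k \<Rightarrow> complex" where
  "coeffs_of K L = (SOME a. a \<in> ell1_coeffs K \<and> discrete_measure K a = L)"

definition push_operator ::
  "'k topology \<Rightarrow> ('k \<Rightarrow> 'k) \<Rightarrow> (('k \<Rightarrow> complex) \<Rightarrow> complex) \<Rightarrow> (('k \<Rightarrow> complex) \<Rightarrow> complex)" where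
  "push_operator K h = (\<lambda>L\<in>ell1 K. discrete_measure K (push_coeffs K h (coeffs_of K L)))"

lemma
  assumes "L \<in> ell1 K"
  shows coeffs_of_in: "coeffs_of K L \<in> ell1_coeffs K"
    and discrete_measure_coeffs_of: "discrete_measure K (coeffs_of K L) = L"
proof -
  have "\<exists>a. a \<in> ell1_coeffs K \<and> discrete_measure K a = L"
    using assms by (auto simp: ell1_eq)
  from someI_ex[OF this]
  show "coeffs_of K L \<in> ell1_coeffs K" "discrete_measure K (coeffs_of K L) = L"
    by (simp_all add: coeffs_of_def)
qed

lemma push_operator_apply:
  assumes K: "compact_space K" and h: "h \<in> topspace K \<rightarrow> topspace K"
    and L: "L \<in> ell1 K" and f: "f \<in> C_space K"
  shows "push_operator K h L f = (\<Sum>\<^sub>\<infinity>x\<in>topspace K. coeffs_of K L x * f (h x))"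
  using infsum_push_coeffs[OF h coeffs_of_in[OF L] norm_le_sup_norm[OF K f]] L f
  by (simp add: push_operator_def discrete_measure_def)

lemma push_operator_in_ell1:
  assumes "h \<in> topspace K \<rightarrow> topspace K" "L \<in> ell1 K"
  shows "push_operator K h L \<in> ell1 K"
  using push_coeffs_in[OF assms(1) coeffs_of_in[OF assms(2)]] assms(2)
  by (simp add: push_operator_def ell1_eq)

text \<open>The terms are dominated by \<open>|a\<^sub>x|\<close> times the norm of \<open>f\<close>, uniformly in \<open>h\<close>, so the Weierstrass test
  reduces the claim to finite sums.\<close>

lemma continuous_map_infsum_eval:
  assumes K: "compact_space K" and a: "a \<in> ell1_coeffs K" and f: "f \<in> C_space K"
  shows "continuous_map (product_topology (\<lambda>_. K) (topspace K)) euclidean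
           (\<lambda>h. \<Sum>\<^sub>\<infinity>x\<in>topspace K. a x * f (h x))"
proof -
  let ?P = "product_topology (\<lambda>_. K) (topspace K)" and ?F = "finite_subsets_at_top (topspace K)"
  have "uniform_limit (topspace ?P) (\<lambda>I h. \<Sum>x\<in>I. a x * f (h x)) (\<lambda>h. \<Sum>\<^sub>\<infinity>x\<in>topspace K. a x * f (h x)) ?F"
  proof (rule Weierstrass_m_test_general)
    show "norm (a x * f (h x)) \<le> norm (a x) * sup_norm K f" if "x \<in> topspace K" "h \<in> topspace ?P" for x h
      using that norm_le_sup_norm[OF K f, of "h x"] by (auto simp: norm_mult intro!: mult_left_mono)
    show "(\<lambda>x. norm (a x) * sup_norm K f) summable_on topspace K"
      using a by (intro summable_on_cmult_left) (simp add: ell1_coeffs_def)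
  qed
  then have lim: "\<forall>\<^sub>F I in ?F. \<forall>h\<in>topspace ?P. dist (\<Sum>x\<in>I. a x * f (h x)) (\<Sum>\<^sub>\<infinity>x\<in>topspace K. a x * f (h x)) < e"
    if "e > 0" for e
    using that by (simp add: uniform_limit_iff)
  have "continuous_map ?P euclidean (\<lambda>h. a x * f (h x))" if "x \<in> topspace K" for x
  proof -
    have "continuous_map K euclidean f"
      using f by (simp add: C_space_def)
    then have "continuous_map ?P euclidean (f \<circ> (\<lambda>h. h x))"
      using that by (intro continuous_map_compose[where X' = K] continuous_map_product_projection) auto
    then have "continuous_map ?P euclidean ((\<lambda>z. a x * z) \<circ> (f \<circ> (\<lambda>h. h x)))"
      by (rule continuous_map_compose) (auto intro!: continuous_intros)
    then show ?thesis
      by (simp add: o_def)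
  qed
  then have "\<forall>\<^sub>F I in ?F. continuous_map ?P euclidean (\<lambda>h. \<Sum>x\<in>I. a x * f (h x))"
    by (intro eventually_finite_subsets_at_top_weakI continuous_map_sum) auto
  then show ?thesis
    using Met_TC.continuous_map_uniform_limit[of ?P "\<lambda>I h. \<Sum>x\<in>I. a x * f (h x)" ?F] lim
    by (simp add: mtopology_is_euclidean)
qed

lemma continuous_map_push_operator:
  assumes K: "compact_space K"
  shows "continuous_map (product_topology (\<lambda>_. K) (topspace K))
           (product_topology (\<lambda>_. ell1_topology K) (ell1 K)) (push_operator K)"
proof -
  let ?P = "product_topology (\<lambda>_. K) (topspace K)"
  have "continuous_map ?P (ell1_topology K) (\<lambda>h. push_operator K h L)" if L: "L \<in> ell1 K" for L
  proof -
    have "continuous_map ?P euclidean (\<lambda>h. push_operator K h L f)" if f: "f \<in> C_space K" for f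
      by (rule continuous_map_eq[OF continuous_map_infsum_eval[OF K coeffs_of_in[OF L] f]])
        (auto simp: PiE_def intro!: push_operator_apply[OF K _ L f, symmetric])
    then show ?thesis
      using push_operator_in_ell1[OF _ L]
      by (auto simp: continuous_map_into_ell1_topology[OF K])
  qed
  then show ?thesis
    by (auto simp: continuous_map_componentwise push_operator_def)
qed

section \<open>The maps of the action and their limits\<close>

locale dynamical_system =
  fixes K :: "'k topology" and S :: "'s topology"
    and mul :: "'s \<Rightarrow> 's \<Rightarrow> 's" and act :: "'s \<Rightarrow> 'k \<Rightarrow> 'k"
  assumes tds: "topological_dynamical_system K S mul act"
begin

abbreviation "X \<equiv> topspace K"
abbreviation "KK \<equiv> product_topology (\<lambda>_. K) X"
abbreviation "LL \<equiv> product_topology (\<lambda>_. ell1_topology K) (ell1 K)"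
abbreviation "orbit_maps \<equiv> {restrict (act s) X | s. s \<in> topspace S}"
abbreviation "dual_koopmans \<equiv> {restrict (koopman_dual K act s) (ell1 K) | s. s \<in> topspace S}"
abbreviation "ellis_set \<equiv> KK closure_of orbit_maps"
abbreviation "operator_ellis_set \<equiv> LL closure_of dual_koopmans"

lemma compact: "compact_space K" and Hausdorff: "Hausdorff_space K"
  using tds by (auto simp: topological_dynamical_system_def)

lemma mul_closed: "s \<in> topspace S \<Longrightarrow> t \<in> topspace S \<Longrightarrow> mul s t \<in> topspace S"
  using tds by (auto simp: topological_dynamical_system_def semitopological_semigroup_def semigroup_on_def)

lemma act_mul: "s \<in> topspace S \<Longrightarrow> t \<in> topspace S \<Longrightarrow> x \<in> X \<Longrightarrow> act (mul s t) x = act s (act t x)"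
  using tds by (auto simp: topological_dynamical_system_def)

lemma continuous_act:
  assumes "s \<in> topspace S"
  shows "continuous_map K K (act s)"
proof -
  have "continuous_map K (prod_topology S K) (\<lambda>x. (s, x))"
    using assms by (simp add: continuous_map_pairwise o_def)
  moreover have "continuous_map (prod_topology S K) K (\<lambda>(s, x). act s x)"
    using tds by (simp add: topological_dynamical_system_def)
  ultimately have "continuous_map K K ((\<lambda>(s, x). act s x) \<circ> (\<lambda>x. (s, x)))"
    by (rule continuous_map_compose)
  then show ?thesis
    by (simp add: o_def)
qed

lemma act_in: "s \<in> topspace S \<Longrightarrow> x \<in> X \<Longrightarrow> act s x \<in> X"
  using continuous_map_funspace[OF continuous_act] by auto

lemma koopman_in: 
  assumes "s \<in> topspace S" "f \<in> C_space K"
  shows "koopman K act s f \<in> C_space K"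
proof -
  have "continuous_map K euclidean (f \<circ> act s)"
    using assms(2) by (intro continuous_map_compose[OF continuous_act[OF assms(1)]]) (simp add: C_space_def)
  then show ?thesis
    unfolding C_space_def koopman_def by (auto intro: continuous_map_eq)
qed

lemma koopman_dual_discrete_measure:
  assumes "s \<in> topspace S"
  shows "koopman_dual K act s (discrete_measure K a) = (\<lambda>f\<in>C_space K. \<Sum>\<^sub>\<infinity>x\<in>X. a x * f (act s x))"
  unfolding koopman_dual_def
  by (rule restrict_ext)
    (simp add: discrete_measure_def koopman_in[OF assms], simp add: koopman_def cong: infsum_cong)

lemma push_operator_orbit_map:
  assumes s: "s \<in> topspace S"
  shows "push_operator K (restrict (act s) X) = restrict (koopman_dual K act s) (ell1 K)"
proof (rule extensionalityI[where A = "ell1 K"])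
  fix L assume L: "L \<in> ell1 K"
  have "push_operator K (restrict (act s) X) L f = koopman_dual K act s L f" if f: "f \<in> C_space K" for f
  proof -
    have "push_operator K (restrict (act s) X) L f = (\<Sum>\<^sub>\<infinity>x\<in>X. coeffs_of K L x * f (act s x))"
      using act_in[OF s] by (subst push_operator_apply[OF compact _ L f]) (auto intro: infsum_cong)
    also have "\<dots> = koopman_dual K act s (discrete_measure K (coeffs_of K L)) f"
      using f by (simp add: koopman_dual_discrete_measure[OF s])
    finally show ?thesis
      by (simp add: discrete_measure_coeffs_of[OF L])
  qed
  moreover have "push_operator K (restrict (act s) X) L \<in> extensional (C_space K)"
    using L by (simp add: push_operator_def discrete_measure_def)
  moreover have "koopman_dual K act s L \<in> extensional (C_space K)"
    by (simp add: koopman_dual_def)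
  ultimately show "push_operator K (restrict (act s) X) L = restrict (koopman_dual K act s) (ell1 K) L"
    using L by (auto intro: extensionalityI)
qed (auto simp: push_operator_def)

lemma orbit_maps_subset: "orbit_maps \<subseteq> topspace KK"
  using act_in by auto

lemma ellis_set_subset: "ellis_set \<subseteq> X \<rightarrow>\<^sub>E X"
  using closure_of_subset_topspace[of KK orbit_maps] by simp

lemma ellis_set_apply: "h \<in> ellis_set \<Longrightarrow> x \<in> X \<Longrightarrow> h x \<in> X"
  by (rule PiE_mem[OF subsetD[OF ellis_set_subset]])

lemma ellis_set_extensional: "h \<in> ellis_set \<Longrightarrow> h \<in> extensional X"
  using subsetD[OF ellis_set_subset, of h] by (simp only: PiE_iff)

lemma push_operator_orbit_maps: "push_operator K ` orbit_maps = dual_koopmans"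
  using push_operator_orbit_map by (auto simp: image_iff) metis

text \<open>For \<open>h = \<phi>\<^sub>s\<close> both sides are the value of the given functional at \<open>T\<^sub>s f\<close>, hence equal; both sides
  are continuous in \<open>h\<close>, so the equality passes to the closure.\<close>

lemma infsum_eq_of_discrete_measure_eq:
  assumes a: "a \<in> ell1_coeffs K" and b: "b \<in> ell1_coeffs K"
    and eq: "discrete_measure K a = discrete_measure K b"
    and h: "h \<in> ellis_set" and f: "f \<in> C_space K"
  shows "(\<Sum>\<^sub>\<infinity>x\<in>X. a x * f (h x)) = (\<Sum>\<^sub>\<infinity>x\<in>X. b x * f (h x))"
proof (rule forall_in_closure_of_eq[OF h Hausdorff_space_euclidean
      continuous_map_infsum_eval[OF compact a f] continuous_map_infsum_eval[OF compact b f]])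
  fix t assume "t \<in> orbit_maps"
  then obtain s where s: "s \<in> topspace S" and t: "t = restrict (act s) X"
    by auto
  have "koopman_dual K act s (discrete_measure K a) f = koopman_dual K act s (discrete_measure K b) f"
    by (simp add: eq)
  then show "(\<Sum>\<^sub>\<infinity>x\<in>X. a x * f (t x)) = (\<Sum>\<^sub>\<infinity>x\<in>X. b x * f (t x))"
    using f by (simp add: koopman_dual_discrete_measure[OF s] t cong: infsum_cong)
qed

text \<open>The chosen coefficients of \<open>\<delta>\<^sub>x\<close> may be replaced by the indicator of \<open>x\<close>.\<close>

lemma push_operator_dirac:
  assumes h: "h \<in> ellis_set" and x: "x \<in> X"
  shows "push_operator K h (dirac K x) = dirac K (h x)"
proof (rule extensionalityI[where A = "C_space K"])
  obtain a where a: "a \<in> ell1_coeffs K" "dirac K x = discrete_measure K a"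
    "\<And>g. (\<Sum>\<^sub>\<infinity>y\<in>X. a y * g y) = g x"
    using dirac_eq_discrete_measure[OF x] by blast
  note L = dirac_in_ell1[OF x]
  fix f assume f: "f \<in> C_space K"
  have "push_operator K h (dirac K x) f = (\<Sum>\<^sub>\<infinity>y\<in>X. coeffs_of K (dirac K x) y * f (h y))"
    using ellis_set_apply[OF h] by (intro push_operator_apply[OF compact _ L f]) auto
  also have "\<dots> = (\<Sum>\<^sub>\<infinity>y\<in>X. a y * f (h y))"
    by (rule infsum_eq_of_discrete_measure_eq[OF coeffs_of_in[OF L] a(1) _ h f])
      (use discrete_measure_coeffs_of[OF L] a(2) in metis)
  also have "\<dots> = dirac K (h x) f"
    using a(3)[of "\<lambda>y. f (h y)"] f by (simp add: dirac_def)
  finally show "push_operator K h (dirac K x) f = dirac K (h x) f" .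
qed (use dirac_in_ell1[OF x] in \<open>auto simp: push_operator_def discrete_measure_def dirac_def\<close>)

lemma restrict_to_points_push_operator:
  assumes h: "h \<in> ellis_set"
  shows "restrict_to_points K (push_operator K h) = h"
proof (rule extensionalityI[where A = X])
  fix x assume x: "x \<in> X"
  then have "h x \<in> X"
    by (rule ellis_set_apply[OF h])
  with x show "restrict_to_points K (push_operator K h) x = h x"
    by (simp add: restrict_to_points_def push_operator_dirac[OF h]
        the_inv_into_f_f[OF inj_on_dirac[OF compact Hausdorff]])
qed (simp_all add: restrict_to_points_def ellis_set_extensional[OF h])

lemma topspace_ellis_set: "topspace (subtopology KK ellis_set) = ellis_set"
  using closure_of_subset_topspace[of KK orbit_maps] by auto

lemma topspace_operator_ellis_set: "topspace (subtopology LL operator_ellis_set) = operator_ellis_set"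
  using closure_of_subset_topspace[of LL dual_koopmans] by auto

lemma compact_ellis_set: "compactin KK ellis_set"
  by (intro closedin_compact_space) (simp_all add: compact_space_product_topology compact)

lemma Hausdorff_LL: "Hausdorff_space LL"
  by (simp add: Hausdorff_space_product_topology Hausdorff_ell1_topology)

text \<open>One inclusion is continuity.  For the other, the image of a compact set in a Hausdorff space is
  closed, and it contains the dual Koopman operators.\<close>

lemma push_operator_image_ellis_set: "push_operator K ` ellis_set = operator_ellis_set"
proof
  show "push_operator K ` ellis_set \<subseteq> operator_ellis_set"
    using continuous_map_image_closure_subset[OF continuous_map_push_operator[OF compact], of orbit_maps]
    by (simp add: push_operator_orbit_maps)
  have "closedin LL (push_operator K ` ellis_set)"
    by (rule compactin_imp_closedin[OF Hausdorff_LL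
          image_compactin[OF compact_ellis_set continuous_map_push_operator[OF compact]]])
  moreover have "dual_koopmans \<subseteq> push_operator K ` ellis_set"
    using closure_of_subset[OF orbit_maps_subset] push_operator_orbit_maps by blast
  ultimately show "operator_ellis_set \<subseteq> push_operator K ` ellis_set"
    by (intro closure_of_minimal)
qed

lemma OE_is_push_operator:
  assumes "R \<in> operator_ellis_set"
  obtains h where "h \<in> ellis_set" "R = push_operator K h"
  using assms unfolding push_operator_image_ellis_set[symmetric] by (rule imageE) (rule that)

lemma homeomorphic_map_restrict_to_points:
  "homeomorphic_map (subtopology LL operator_ellis_set) (subtopology KK ellis_set) (restrict_to_points K)"
proof -
  have "homeomorphic_map (subtopology KK ellis_set) (subtopology LL operator_ellis_set) (push_operator K)"
  proof (rule continuous_imp_homeomorphic_map)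
    show "continuous_map (subtopology KK ellis_set) (subtopology LL operator_ellis_set) (push_operator K)"
      using push_operator_image_ellis_set continuous_map_push_operator[OF compact] topspace_ellis_set
      by (auto simp: continuous_map_in_subtopology intro: continuous_map_from_subtopology)
    show "compact_space (subtopology KK ellis_set)"
      by (rule compact_space_subtopology[OF compact_ellis_set])
    show "Hausdorff_space (subtopology LL operator_ellis_set)"
      by (rule Hausdorff_space_subtopology[OF Hausdorff_LL])
    show "push_operator K ` topspace (subtopology KK ellis_set) = topspace (subtopology LL operator_ellis_set)"
      by (simp only: topspace_ellis_set topspace_operator_ellis_set push_operator_image_ellis_set)
    show "inj_on (push_operator K) (topspace (subtopology KK ellis_set))"
      unfolding topspace_ellis_set by (rule inj_on_inverseI[where g = "restrict_to_points K"]) (rule restrict_to_points_push_operator)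
  qed
  then obtain r where r: "homeomorphic_maps (subtopology KK ellis_set) (subtopology LL operator_ellis_set) (push_operator K) r"
    by (auto simp: homeomorphic_map_maps)
  then have hom: "homeomorphic_map (subtopology LL operator_ellis_set) (subtopology KK ellis_set) r"
    by (simp add: homeomorphic_maps_map)
  show ?thesis
  proof (rule homeomorphic_map_eq[OF hom])
    fix R assume "R \<in> topspace (subtopology LL operator_ellis_set)"
    then have "R \<in> operator_ellis_set"
      by (simp only: topspace_operator_ellis_set)
    then obtain h where h: "h \<in> ellis_set" "R = push_operator K h"
      by (rule OE_is_push_operator)
    moreover have "r (push_operator K h) = h"
      using r h(1) topspace_ellis_set by (simp add: homeomorphic_maps_map)
    ultimately show "r R = restrict_to_points K R"
      by (simp add: restrict_to_points_push_operator)
  qed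
qed

lemma right_topological_semigroup_ellis_set:
  "right_topological_semigroup (subtopology KK ellis_set) (compose X)"
proof (rule right_topological_semigroup_closure_of)
  fix s t assume "s \<in> orbit_maps" "t \<in> orbit_maps"
  then obtain u v where uv: "u \<in> topspace S" "v \<in> topspace S"
    "s = restrict (act u) X" "t = restrict (act v) X"
    by auto
  then have "compose X s t = restrict (act (mul u v)) X"
    by (auto simp: compose_def act_mul act_in)
  then show "compose X s t \<in> orbit_maps"
    using mul_closed[OF uv(1,2)] by blast
qed (auto intro: continuous_map_eq[OF continuous_act])

lemma koopman_dual_in_ell1:
  assumes "s \<in> topspace S" "L \<in> ell1 K"
  shows "koopman_dual K act s L \<in> ell1 K"
  using push_operator_in_ell1[of "restrict (act s) X" K L] push_operator_orbit_map[OF assms(1)]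
    act_in[OF assms(1)] assms(2) by simp

lemma koopman_dual_mul:
  assumes "u \<in> topspace S" "v \<in> topspace S"
  shows "koopman_dual K act u (koopman_dual K act v L) = koopman_dual K act (mul u v) L"
proof -
  have "koopman K act v (koopman K act u f) = koopman K act (mul u v) f" for f
    using assms by (auto simp: koopman_def act_in act_mul)
  then show ?thesis
    unfolding koopman_dual_def using koopman_in[OF assms(1)] by (auto simp: restrict_def)
qed

lemma continuous_koopman_dual:
  assumes "s \<in> topspace S"
  shows "continuous_map (ell1_topology K) (ell1_topology K) (koopman_dual K act s)"
  using koopman_dual_in_ell1[OF assms] continuous_map_ell1_eval[OF koopman_in[OF assms]]
  by (auto simp: continuous_map_into_ell1_topology[OF compact] topspace_ell1_topology[OF compact]
      koopman_dual_def)

lemma right_topological_semigroup_operator_ellis_set: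
  "right_topological_semigroup (subtopology LL operator_ellis_set) (compose (ell1 K))"
proof -
  have top: "topspace (ell1_topology K) = ell1 K"
    by (rule topspace_ell1_topology[OF compact])
  have cont: "continuous_map (ell1_topology K) (ell1_topology K) T" if "T \<in> dual_koopmans" for T
    using that by (auto simp: top intro: continuous_map_eq[OF continuous_koopman_dual])
  have mult: "compose (ell1 K) T U \<in> dual_koopmans"
    if "T \<in> dual_koopmans" "U \<in> dual_koopmans" for T U
  proof -
    from that obtain u v where uv: "u \<in> topspace S" "v \<in> topspace S"
      "T = restrict (koopman_dual K act u) (ell1 K)" "U = restrict (koopman_dual K act v) (ell1 K)"
      by auto
    then have "compose (ell1 K) T U = restrict (koopman_dual K act (mul u v)) (ell1 K)"
      by (auto simp: compose_def koopman_dual_mul koopman_dual_in_ell1)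
    then show ?thesis
      using mul_closed[OF uv(1,2)] by blast
  qed
  have "dual_koopmans \<subseteq> extensional (ell1 K)"
    by auto
  with right_topological_semigroup_closure_of[of dual_koopmans "ell1_topology K"] cont mult
  show ?thesis
    by (simp only: top)
qed

text \<open>With \<open>R\<close> and \<open>Q\<close> induced by \<open>h\<close> and \<open>g\<close>, both sides are \<open>h \<circ> g\<close>, because \<open>R (Q \<delta>\<^sub>x) = R \<delta>\<^bsub>g x\<^esub>\<close>.\<close>

lemma restrict_to_points_compose:
  assumes R: "R \<in> operator_ellis_set" and Q: "Q \<in> operator_ellis_set"
  shows "restrict_to_points K (compose (ell1 K) R Q) =
    compose X (restrict_to_points K R) (restrict_to_points K Q)"
proof -
  from R obtain h where h: "h \<in> ellis_set" "R = push_operator K h"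
    by (rule OE_is_push_operator)
  from Q obtain g where g: "g \<in> ellis_set" "Q = push_operator K g"
    by (rule OE_is_push_operator)
  have gx: "g x \<in> X" "h (g x) \<in> X" if "x \<in> X" for x
    using ellis_set_apply[OF h(1)] ellis_set_apply[OF g(1)] that by simp_all
  have "restrict_to_points K (compose (ell1 K) R Q) = compose X h g"
    unfolding restrict_to_points_def compose_def
    using gx by (intro restrict_ext)
      (simp add: h(2) g(2) dirac_in_ell1 push_operator_dirac[OF h(1)] push_operator_dirac[OF g(1)]
        the_inv_into_f_f[OF inj_on_dirac[OF compact Hausdorff]])
  then show ?thesis
    by (simp only: h(2) g(2) restrict_to_points_push_operator[OF h(1)]
        restrict_to_points_push_operator[OF g(1)])
qed

end

theorem mainTheorem3:
  fixes K :: "'k topology" and S :: "'s topology"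
    and mul :: "'s \<Rightarrow> 's \<Rightarrow> 's" and act :: "'s \<Rightarrow> 'k \<Rightarrow> 'k"
  assumes "topological_dynamical_system K S mul act"
  shows "embedding_map K (weak_star K) (dirac K) \<and>
    (\<forall>R\<in>topspace (operator_ellis_semigroup K S act).
       R ` (dirac K ` topspace K) \<subseteq> dirac K ` topspace K) \<and>
    right_topological_semigroup_iso
      (operator_ellis_semigroup K S act) (compose (ell1 K))
      (ellis_semigroup K S act) (compose (topspace K))
      (restrict_to_points K)"
proof -
  interpret dynamical_system K S mul act
    by unfold_locales (rule assms)
  have O: "operator_ellis_semigroup K S act = subtopology LL operator_ellis_set"
    by (simp add: operator_ellis_semigroup_def Let_def)
  have E: "ellis_semigroup K S act = subtopology KK ellis_set"
    by (simp add: ellis_semigroup_def Let_def)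
  have points: "R ` (dirac K ` X) \<subseteq> dirac K ` X" if "R \<in> operator_ellis_set" for R
  proof (intro image_subsetI, elim imageE)
    from that obtain h where h: "h \<in> ellis_set" "R = push_operator K h"
      by (rule OE_is_push_operator)
    fix y x assume "y = dirac K x" "x \<in> X"
    then show "R y \<in> dirac K ` X"
      using ellis_set_apply[OF h(1)] by (simp add: h(2) push_operator_dirac[OF h(1)])
  qed
  have "right_topological_semigroup_iso
      (operator_ellis_semigroup K S act) (compose (ell1 K))
      (ellis_semigroup K S act) (compose (topspace K)) (restrict_to_points K)"
    unfolding right_topological_semigroup_iso_def O E topspace_operator_ellis_set
    by (intro conjI ballI right_topological_semigroup_operator_ellis_set right_topological_semigroup_ellis_set
        homeomorphic_map_restrict_to_points restrict_to_points_compose)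
  moreover have "\<forall>R\<in>topspace (operator_ellis_semigroup K S act). R ` (dirac K ` X) \<subseteq> dirac K ` X"
    unfolding O topspace_operator_ellis_set by (intro ballI points)
  ultimately show ?thesis
    by (intro conjI embedding_map_dirac[OF compact Hausdorff])
qed

end
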